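(* Consider the following non-adaptive randomized algorithm, given $V$ (with $|V|=n$), CC-oracle access to a hidden graph $G$ on $V$, and the maximum degree $\Delta$ of $G$: initialize $H$ to the complete graph on $V$; then $t=\mathcal{O}(\Delta^2\log n)$ times (with a suitable constant), independently sample $Q\subseteq V$ by including each vertex independently with probability $1/(\Delta+1)$, query $\mathcal{C}=\mathrm{CC}(Q)$, and for all $u,v\in Q$ lying in different components of $\mathcal{C}$ remove the edge $uv$ from $H$; finally output $H$. This algorithm solves the Graph Reconstruction problem with $\mathcal{O}(\Delta^2 \log n)$ CC queries, and its output equals $G$ with high probability.
   Context: Graph Reconstruction (GR): an unknown ("hidden") simple undirected graph $G=(V,E)$ on a known vertex set $V$ with $|V|=n$ is to be determined. A CC oracle, on query $S\subseteq V$, returns the partition of $S$ into the vertex sets of the connected components of the induced subgraph $G[S]$. A non-adaptive algorithm fixes all its (possibly random) queries before seeing answers. "With high probability" means with probability tending to $1$ as $n\to\infty$.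
   Formalization: In the number of repetitions and the query bound, Δ² is read as max(1,Δ)², since for Δ = 0 the literal bound gives zero queries and the algorithm would output the complete graph instead of the edgeless one; nothing changes for Δ ≥ 1. *)

theory Defs
  imports
    "HOL-Probability.Product_PMF"
    "Graph_Theory.Digraph_Component"
begin

text \<open>
  A finite simple undirected graph is a \<^locale>\<open>pair_graph\<close>: a loop-free digraph on finitely many
  vertices with a symmetric set of arcs, an undirected edge \<open>uv\<close> being the pair of arcs
  \<open>(u, v)\<close>, \<open>(v, u)\<close>. Hence the degree of a vertex is its out-degree.
\<close>

definition max_degree :: "'a pair_pre_digraph \<Rightarrow> nat" where
  "max_degree G = Max (out_degree (with_proj G) ` pverts G)"

text \<open>
  \<open>Digraph_Component.connected\<close> excludes the graph without vertices, so the oracle answers the empty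
  query with the empty partition.
\<close>

definition cc_oracle :: "'a pair_pre_digraph \<Rightarrow> 'a set \<Rightarrow> 'a set set" where
  "cc_oracle G S =
     verts ` {H. pre_digraph.max_subgraph (with_proj G \<restriction> S) Digraph_Component.connected H}"

text \<open>
  A non-adaptive algorithm is a distribution of query lists together with a function computing the
  output from the list of queries paired with their answers. All queries are drawn before the
  oracle is consulted, and the number of queries is the length of the list.
\<close>

definition run_nonadaptive ::
  "'q list pmf \<Rightarrow> (('q \<times> 'r) list \<Rightarrow> 'o) \<Rightarrow> ('q \<Rightarrow> 'r) \<Rightarrow> 'o pmf" where
  "run_nonadaptive queries output oracle =
     map_pmf (\<lambda>qs. output (map (\<lambda>q. (q, oracle q)) qs)) queries"

definition random_subset :: "'a set \<Rightarrow> real \<Rightarrow> 'a set pmf" where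
  "random_subset V p = map_pmf (\<lambda>f. {v \<in> V. f v}) (Pi_pmf V False (\<lambda>_. bernoulli_pmf p))"

definition random_queries :: "'a set \<Rightarrow> nat \<Rightarrow> nat \<Rightarrow> 'a set list pmf" where
  "random_queries V \<Delta> t = replicate_pmf t (random_subset V (1 / (real \<Delta> + 1)))"

definition complete_graph :: "'a set \<Rightarrow> 'a pair_pre_digraph" where
  "complete_graph V = \<lparr> pverts = V, parcs = {(u, v). u \<in> V \<and> v \<in> V \<and> u \<noteq> v} \<rparr>"

definition remove_separated ::
  "'a set \<times> 'a set set \<Rightarrow> 'a pair_pre_digraph \<Rightarrow> 'a pair_pre_digraph" where
  "remove_separated = (\<lambda>(Q, C) H. H\<lparr> parcs := parcs H -
     {(u, v). u \<in> Q \<and> v \<in> Q \<and> (\<exists>A\<in>C. \<exists>B\<in>C. A \<noteq> B \<and> u \<in> A \<and> v \<in> B)} \<rparr>)"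

definition reconstruct :: "'a set \<Rightarrow> ('a set \<times> 'a set set) list \<Rightarrow> 'a pair_pre_digraph" where
  "reconstruct V answers = fold remove_separated answers (complete_graph V)"

text \<open>
  The number of repetitions is \<open>c \<Delta>\<^sup>2 ln n\<close>, rounded up. Taken literally, this would be \<open>0\<close>
  for \<open>\<Delta> = 0\<close>, and the algorithm would output the complete graph; as usual for asymptotic bounds,
  \<open>\<Delta>\<close> is therefore read as \<open>max 1 \<Delta>\<close>, which changes nothing for \<open>\<Delta> \<ge> 1\<close>.
\<close>

definition repetitions :: "real \<Rightarrow> nat \<Rightarrow> nat \<Rightarrow> nat" where
  "repetitions c \<Delta> n = nat \<lceil>c * (real (max 1 \<Delta>))\<^sup>2 * ln (real n)\<rceil>"

end

theory Submission
  imports Defs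
begin

text \<open>
  A query never separates the endpoints of an edge. Conversely, for non-adjacent \<open>u \<noteq> v\<close>, a query
  that contains \<open>u\<close> and \<open>v\<close> but no neighbour of \<open>u\<close> makes \<open>u\<close> an isolated vertex and so separates
  \<open>u\<close> from \<open>v\<close>. With \<open>p = 1 / (\<Delta> + 1)\<close> this has probability at least
  \<open>p\<^sup>2 (1 - p)\<^sup>\<Delta> \<ge> 1 / (4 e \<Delta>\<^sup>2)\<close>, so \<open>12 e \<Delta>\<^sup>2 ln n\<close> independent queries all miss a given pair with
  probability at most \<open>1 / n\<^sup>3\<close>, and a union bound over the fewer than \<open>n\<^sup>2\<close> non-adjacent ordered
  pairs leaves an error probability of at most \<open>1 / n\<close>.
\<close>

section \<open>Components of a symmetric digraph\<close>

lemma (in wf_digraph) strongly_connected_imp_connected: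
  assumes "strongly_connected G"
  shows "Digraph_Component.connected G"
  using assms by (auto simp: connected_def strongly_connected_def intro: reachable_mk_symmetricI)

text \<open>Symmetry is inherited by induced subgraphs; an arbitrary subgraph may keep only one of
  two opposite arcs.\<close>

lemma (in sym_digraph) induced_connected_imp_strongly_connected:
  assumes "induced_subgraph H G" "Digraph_Component.connected H"
  shows "strongly_connected H"
proof -
  interpret H: wf_digraph H
    using assms(1) by (rule wf_digraphI_induced)
  have "symmetric H"
    using sym_arcs assms(1) by (rule induced_graph_imp_symmetric)
  then show ?thesis
    using assms(2) by (rule H.symmetric_connected_imp_strongly_connected)
qed

text \<open>Adding arcs on a fixed vertex set preserves connectedness, so maximal connected
  subgraphs are induced.\<close>

lemma arc_mono_connected: "arc_mono Digraph_Component.connected"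
  by (auto simp: arc_mono_def)
     (metis spanning_def subgraphE wf_digraph.connected_spanning_imp_connected)

lemma subgraph_antisym:
  assumes "subgraph H K" "subgraph K H"
  shows "H = (K :: ('a, 'b) pre_digraph)"
  using assms by (auto simp: subgraph_def compatible_def)

text \<open>Connected subgraphs need not be strongly connected, but the maximal ones are induced,
  hence symmetric, hence strongly connected. This makes directed reachability available for oracle
  answers.\<close>

lemma (in sym_digraph) max_connected_eq_sccs:
  "{H. max_subgraph Digraph_Component.connected H} = sccs"
  unfolding sccs_altdef2
proof (intro Collect_cong iffI)
  fix H assume H: "max_subgraph Digraph_Component.connected H"
  then have "induced_subgraph H G"
    by (rule induced_subgraphI_arc_mono) (rule arc_mono_connected)
  then have "strongly_connected H"
    using H by (auto dest: max_subgraph_prop intro: induced_connected_imp_strongly_connected)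
  moreover have "Digraph_Component.connected K" if "subgraph K G" "strongly_connected K" for K
    using that by (auto intro: wf_digraph.strongly_connected_imp_connected)
  ultimately show "max_subgraph strongly_connected H"
    using H by (auto simp: max_subgraph_def)
next
  fix H assume H: "max_subgraph strongly_connected H"
  show "max_subgraph Digraph_Component.connected H"
  proof (rule max_subgraphI)
    show sub: "subgraph H G"
      using H by (rule subgraphI_max_subgraph)
    then interpret H: wf_digraph H by (rule subgraphE)
    show "Digraph_Component.connected H"
      using max_subgraph_prop[OF H] by (rule H.strongly_connected_imp_connected)
    fix K assume K: "H \<noteq> K" "subgraph H K" "subgraph K G"
    show "\<not> Digraph_Component.connected K"
    proof
      assume conn: "Digraph_Component.connected K"
      \<comment> \<open>\<open>K\<close> may be asymmetric; the induced subgraph on its vertices is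
        symmetric and still lies above \<open>H\<close>.\<close>
      let ?K = "G \<restriction> verts K"
      have ind: "induced_subgraph ?K G"
        using K(3) by (intro induced_induce) auto
      have KK: "subgraph K ?K"
        using K(3) by (rule subgraph_induce_subgraphI2)
      then have "Digraph_Component.connected ?K"
        using arc_mono_connected conn unfolding arc_mono_def by (metis induce_subgraph_verts)
      then have "strongly_connected ?K"
        using ind by (intro induced_connected_imp_strongly_connected)
      moreover have "subgraph H ?K"
        using K(2) KK by (rule subgraph_trans)
      moreover have "subgraph ?K G"
        using ind by auto
      ultimately have "H = ?K"
        using H by (auto simp: max_subgraph_def)
      then have "H = K"
        using KK K(2) by (auto intro: subgraph_antisym)
      then show False using K(1) by simp
    qed
  qed
qed

lemma (in pair_sym_digraph) sym_digraph_induce: "sym_digraph (with_proj G \<restriction> S)"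
proof
  fix e assume "e \<in> arcs (with_proj G \<restriction> S)"
  then show "tail (with_proj G \<restriction> S) e \<in> verts (with_proj G \<restriction> S)"
    "head (with_proj G \<restriction> S) e \<in> verts (with_proj G \<restriction> S)"
    by auto
next
  show "symmetric (with_proj G \<restriction> S)"
    using pair_sym_arcs by (auto simp: symmetric_def arcs_ends_conv intro!: symI dest: symD)
qed

lemma (in pair_sym_digraph) cc_oracle_eq:
  "cc_oracle G S = pre_digraph.sccs_verts (with_proj G \<restriction> S)"
proof -
  interpret S: sym_digraph "with_proj G \<restriction> S" by (rule sym_digraph_induce)
  show ?thesis
    by (simp add: cc_oracle_def S.max_connected_eq_sccs S.sccs_verts_conv)
qed

text \<open>The set that \<open>remove_separated\<close> subtracts, named so that a whole run
  deletes a union of such sets.\<close>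

definition separates :: "'a set \<times> 'a set set \<Rightarrow> ('a \<times> 'a) set" where
  "separates = (\<lambda>(Q, C). {(u, v). u \<in> Q \<and> v \<in> Q \<and>
     (\<exists>A\<in>C. \<exists>B\<in>C. A \<noteq> B \<and> u \<in> A \<and> v \<in> B)})"

text \<open>The endpoints of an arc inside \<open>S\<close> reach each other there, and distinct
  components are disjoint.\<close>

lemma (in pair_sym_digraph) arc_not_separated:
  assumes "(u, v) \<in> parcs G"
  shows "(u, v) \<notin> separates (S, cc_oracle G S)"
proof
  interpret S: sym_digraph "with_proj G \<restriction> S" by (rule sym_digraph_induce)
  assume "(u, v) \<in> separates (S, cc_oracle G S)"
  then obtain A B where AB: "u \<in> S" "v \<in> S" "A \<noteq> B" "u \<in> A" "v \<in> B"
    "A \<in> S.sccs_verts" "B \<in> S.sccs_verts"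
    by (auto simp: separates_def cc_oracle_eq)
  have "(u, v) \<in> arcs_ends (with_proj G \<restriction> S)"
    using assms AB by (auto simp: arcs_ends_conv image_iff)
  then have "u \<rightarrow>\<^sup>*\<^bsub>with_proj G \<restriction> S\<^esub> v" "v \<rightarrow>\<^sup>*\<^bsub>with_proj G \<restriction> S\<^esub> u"
    using S.graph_symmetric by (auto intro: S.adj_in_verts)
  then have "v \<in> A"
    using AB by (auto simp: S.in_sccs_verts_conv_reachable)
  then show False
    using AB S.sccs_verts_disjoint by blast
qed

text \<open>A path from \<open>u\<close> to \<open>v\<close> inside \<open>S\<close> would need a
  first arc leaving \<open>u\<close>, and there is none.\<close>

lemma (in pair_sym_digraph) isolated_separated:
  assumes "u \<in> S" "v \<in> S" "u \<noteq> v" and isolated: "\<And>w. (u, w) \<in> parcs G \<Longrightarrow> w \<notin> S"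
  shows "(u, v) \<in> separates (S, cc_oracle G S)"
proof -
  interpret S: sym_digraph "with_proj G \<restriction> S" by (rule sym_digraph_induce)
  have "\<not> u \<rightarrow>\<^sup>*\<^bsub>with_proj G \<restriction> S\<^esub> v"
  proof
    assume "u \<rightarrow>\<^sup>*\<^bsub>with_proj G \<restriction> S\<^esub> v"
    then show False
      by (cases rule: S.converse_reachable_cases)
         (use assms in \<open>auto simp: arcs_ends_conv\<close>)
  qed
  then have "S.scc_of u \<noteq> S.scc_of v"
    using S.in_scc_of_self[of v] assms by (auto simp: S.scc_of_def)
  then show ?thesis
    using assms S.scc_of_in_sccs_verts[of u] S.scc_of_in_sccs_verts[of v]
      S.in_scc_of_self[of u] S.in_scc_of_self[of v]
    unfolding separates_def cc_oracle_eq by auto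
qed

section \<open>Correctness of the output\<close>

lemma remove_separated_eq: "remove_separated x H = H\<lparr>parcs := parcs H - separates x\<rparr>"
  by (cases x) (simp add: remove_separated_def separates_def)

lemma parcs_fold_remove_separated:
  "parcs (fold remove_separated xs H) = parcs H - (\<Union>x\<in>set xs. separates x)"
  by (induction xs arbitrary: H) (auto simp: remove_separated_eq)

lemma pverts_fold_remove_separated: "pverts (fold remove_separated xs H) = pverts H"
  by (induction xs arbitrary: H) (simp_all add: remove_separated_eq)

text \<open>The deterministic half: the hypothesis is the good event on query lists whose
  probability is bounded later.\<close>

lemma (in pair_graph) reconstruct_eq:
  assumes "\<And>u v. u \<in> pverts G \<Longrightarrow> v \<in> pverts G \<Longrightarrow> u \<noteq> v \<Longrightarrow> (u, v) \<notin> parcs G \<Longrightarrow>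
    \<exists>Q\<in>set qs. u \<in> Q \<and> v \<in> Q \<and> (\<forall>w. (u, w) \<in> parcs G \<longrightarrow> w \<notin> Q)"
  shows "reconstruct (pverts G) (map (\<lambda>q. (q, cc_oracle G q)) qs) = G"
proof (rule pair_pre_digraph.equality)
  let ?H = "reconstruct (pverts G) (map (\<lambda>q. (q, cc_oracle G q)) qs)"
  show "pverts ?H = pverts G"
    by (simp add: reconstruct_def pverts_fold_remove_separated complete_graph_def)
  have H: "parcs ?H = parcs (complete_graph (pverts G)) - (\<Union>q\<in>set qs. separates (q, cc_oracle G q))"
    by (simp add: reconstruct_def parcs_fold_remove_separated)
  show "parcs ?H = parcs G"
  proof (intro equalityI subrelI)
    fix u v assume "(u, v) \<in> parcs ?H"
    then have uv: "u \<in> pverts G" "v \<in> pverts G" "u \<noteq> v"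
      and "\<forall>q\<in>set qs. (u, v) \<notin> separates (q, cc_oracle G q)"
      unfolding H by (auto simp: complete_graph_def)
    then show "(u, v) \<in> parcs G"
      using assms[OF uv] isolated_separated[of u _ v] by metis
  next
    fix u v assume uv: "(u, v) \<in> parcs G"
    then show "(u, v) \<in> parcs ?H"
      unfolding H using arc_not_separated[OF uv] in_arcsD1 in_arcsD2 no_loops'
      by (auto simp: complete_graph_def)
  qed
qed simp

section \<open>Probability of a correct output\<close>

lemma prob_random_subset:
  assumes "finite V" "A \<subseteq> V" "B \<subseteq> V" "A \<inter> B = {}" "0 \<le> p" "p \<le> 1"
  shows "measure_pmf.prob (random_subset V p) {S. A \<subseteq> S \<and> S \<inter> B = {}} =
    p ^ card A * (1 - p) ^ card B"
proof -
  \<comment> \<open>\<open>C v\<close> holds the admissible coin outcomes at \<open>v\<close>, so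
    the event is a box and its probability a product.\<close>
  define C where "C v = (if v \<in> A then {True} else if v \<in> B then {False} else UNIV)" for v
  have "(\<lambda>f. {v \<in> V. f v}) -` {S. A \<subseteq> S \<and> S \<inter> B = {}} = Pi V C"
    using assms by (auto simp: C_def Pi_def split: if_splits)
  then have "measure_pmf.prob (random_subset V p) {S. A \<subseteq> S \<and> S \<inter> B = {}} =
    (\<Prod>v\<in>V. measure_pmf.prob (bernoulli_pmf p) (C v))"
    using assms by (simp add: random_subset_def measure_Pi_pmf_Pi)
  also have "\<dots> = (\<Prod>v\<in>V. (if v \<in> A then p else 1) * (if v \<in> B then 1 - p else 1))"
    using assms by (intro prod.cong) (auto simp: C_def measure_pmf_single)
  also have "\<dots> = p ^ card A * (1 - p) ^ card B"
    using assms by (simp add: prod.distrib prod.If_cases Int_absorb1)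
  finally show ?thesis .
qed

lemma prob_replicate_pmf_subset:
  "measure_pmf.prob (replicate_pmf t p) {xs. set xs \<subseteq> A} = measure_pmf.prob p A ^ t"
proof (induction t)
  case (Suc t)
  \<comment> \<open>With the first draw fixed to \<open>x\<close>, the rest contributes the
    induction value or 0; integrating over \<open>x\<close> yields one more factor.\<close>
  have "emeasure (replicate_pmf t p) {xs. x \<in> A \<and> set xs \<subseteq> A} =
    ennreal (measure_pmf.prob p A ^ t) * indicator A x" for x
    using Suc by (cases "x \<in> A") (simp_all add: measure_pmf.emeasure_eq_measure)
  then have "emeasure (replicate_pmf (Suc t) p) {xs. set xs \<subseteq> A} =
    ennreal (measure_pmf.prob p A ^ t) * emeasure p A"
    by (simp add: map_pmf_def[symmetric] nn_integral_cmult_indicator vimage_def)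
  then show ?case
    by (simp add: measure_pmf.emeasure_eq_measure power_Suc2
        del: replicate_pmf.simps power_Suc flip: ennreal_mult)
qed simp

text \<open>For positive \<Delta>, \<open>p\<close> is at least 1/(2\<Delta>), and
  \<open>1 - p\<close> is the reciprocal of 1 + 1/\<Delta>, whose \<Delta>-th power is at most
  e.\<close>

lemma isolation_probability_ge:
  fixes \<Delta> :: nat
  defines "p \<equiv> 1 / (real \<Delta> + 1)"
  shows "p\<^sup>2 * (1 - p) ^ \<Delta> \<ge> 1 / (4 * exp 1 * (real (max 1 \<Delta>))\<^sup>2)"
proof (cases "\<Delta> = 0")
  \<comment> \<open>Here \<open>p\<close> is 1 and \<open>(1 - p) ^ 0\<close> is 1, so the left side
    equals 1.\<close>
  case True
  have "1 \<le> 4 * exp (1::real)"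
    using exp_ge_add_one_self[of 1] by linarith
  then show ?thesis using True by (simp add: p_def divide_simps)
next
  case False
  have "(1 + 1 / real \<Delta>) ^ \<Delta> \<le> exp (1 / real \<Delta>) ^ \<Delta>"
    by (intro power_mono) (auto)
  also have "\<dots> = exp 1"
    using False by (simp flip: exp_of_nat_mult)
  finally have "1 / exp 1 \<le> 1 / (1 + 1 / real \<Delta>) ^ \<Delta>"
    using False by (intro divide_left_mono) (auto intro!: mult_pos_pos zero_less_power add_pos_nonneg)
  also have "\<dots> = (1 / (1 + 1 / real \<Delta>)) ^ \<Delta>"
    by (simp add: power_divide)
  also have "1 / (1 + 1 / real \<Delta>) = 1 - p"
    using False by (simp add: p_def field_simps)
  finally have e: "1 / exp 1 \<le> (1 - p) ^ \<Delta>" .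
  have "1 / (2 * real \<Delta>) \<le> p"
    using False by (simp add: p_def field_simps)
  then have "(1 / (2 * real \<Delta>))\<^sup>2 \<le> p\<^sup>2"
    by (intro power_mono) auto
  then have "(1 / (2 * real \<Delta>))\<^sup>2 * (1 / exp 1) \<le> p\<^sup>2 * (1 - p) ^ \<Delta>"
    using e by (intro mult_mono) auto
  moreover have "max 1 \<Delta> = \<Delta>" using False by simp
  ultimately show ?thesis
    by (simp add: power_divide power_mult_distrib mult_ac)
qed

lemma (in pair_graph) card_neighbours_le:
  assumes "u \<in> pverts G"
  shows "card {w. (u, w) \<in> parcs G} \<le> max_degree G"
proof -
  have "bij_betw snd (out_arcs (with_proj G) u) {w. (u, w) \<in> parcs G}"
    by (rule bij_betwI[where g = "Pair u"]) auto
  then have "card {w. (u, w) \<in> parcs G} = out_degree (with_proj G) u"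
    by (simp add: out_degree_def bij_betw_same_card)
  then show ?thesis
    using assms pair_finite_verts by (simp add: max_degree_def)
qed

lemma (in pair_graph) prob_reconstruct_ge:
  assumes n: "card (pverts G) = n" "n > 0"
  shows "measure_pmf.prob (run_nonadaptive
      (random_queries (pverts G) (max_degree G) (repetitions (12 * exp 1) (max_degree G) n))
      (reconstruct (pverts G)) (cc_oracle G)) {G} \<ge> 1 - 1 / real n"
proof -
  let ?V = "pverts G" and ?\<Delta> = "max_degree G"
  define p where "p = 1 / (real ?\<Delta> + 1)"
  define t where "t = repetitions (12 * exp 1) ?\<Delta> n"
  let ?P = "measure_pmf.prob (random_queries ?V ?\<Delta> t)"
  define m where "m = (real (max 1 ?\<Delta>))\<^sup>2"
  have m: "m > 0" by (simp add: m_def)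
  have p: "0 \<le> p" "p \<le> 1" by (auto simp: p_def)
  \<comment> \<open>\<open>I (u, v)\<close> collects the queries that contain both vertices and
    isolate \<open>u\<close>. \<open>N\<close> holds each non-edge in both orders, as
    \<open>reconstruct_eq\<close> demands.\<close>
  define I where "I = (\<lambda>(u, v). {Q. {u, v} \<subseteq> Q \<and> Q \<inter> {w. (u, w) \<in> parcs G} = {}})"
  define N where "N = {(u, v). u \<in> ?V \<and> v \<in> ?V \<and> u \<noteq> v \<and> (u, v) \<notin> parcs G}"
  have N: "N \<subseteq> ?V \<times> ?V" by (auto simp: N_def)
  have finN: "finite N" and cardN: "card N \<le> n\<^sup>2"
    using finite_subset[OF N] card_mono[OF _ N] pair_finite_verts n
    by (auto simp: card_cartesian_product power2_eq_square)
  have survive: "?P {qs. set qs \<subseteq> - I x} \<le> 1 / real n ^ 3" if xN: "x \<in> N" for x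
  proof -
    obtain u v where x: "x = (u, v)" "u \<in> ?V" "v \<in> ?V" "u \<noteq> v" "(u, v) \<notin> parcs G"
      using xN unfolding N_def by blast
    let ?W = "{w. (u, w) \<in> parcs G}"
    let ?q = "measure_pmf.prob (random_subset ?V p) (I x)"
    have "?W \<subseteq> ?V" "u \<notin> ?W"
      by (auto dest: in_arcsD2 no_loops')
    then have "?q = p\<^sup>2 * (1 - p) ^ card ?W"
      using prob_random_subset[of ?V "{u, v}" ?W p] x p pair_finite_verts
      by (simp add: I_def power2_eq_square)
    \<comment> \<open>Having fewer than \<Delta> neighbours only helps, since \<open>1 - p\<close>
      lies between 0 and 1.\<close>
    also have "\<dots> \<ge> p\<^sup>2 * (1 - p) ^ ?\<Delta>"
      using p card_neighbours_le[OF x(2)] by (intro mult_left_mono power_decreasing) auto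
    finally have q: "?q \<ge> 1 / (4 * exp 1 * m)"
      using isolation_probability_ge[of ?\<Delta>] by (simp add: p_def m_def)
    have "12 * exp 1 * m * ln n \<le> real t"
      unfolding t_def repetitions_def m_def by (rule real_nat_ceiling_ge)
    \<comment> \<open>The constant \<open>12 * exp 1\<close> is three times the
      \<open>4 * exp 1\<close> of the isolation bound, which makes the exponent
      \<open>3 * ln n\<close>.\<close>
    then have "1 / (4 * exp 1 * m) * (12 * exp 1 * m * ln n) \<le> ?q * real t"
      using q m n by (intro mult_mono) auto
    moreover have "1 / (4 * exp 1 * m) * (12 * exp 1 * m * ln n) = 3 * ln n"
      using m by (simp add: field_simps)
    ultimately have qt: "3 * ln n \<le> real t * ?q"
      by (simp add: mult.commute)
    have "?P {qs. set qs \<subseteq> - I x} = (1 - ?q) ^ t"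
      using measure_pmf.prob_compl[of "I x" "random_subset ?V p"]
      by (simp add: random_queries_def prob_replicate_pmf_subset p_def Compl_eq_Diff_UNIV)
    also have "\<dots> \<le> exp (- ?q) ^ t"
      using exp_ge_add_one_self[of "- ?q"] by (intro power_mono) auto
    also have "\<dots> = exp (- (real t * ?q))"
      by (simp flip: exp_of_nat_mult)
    also have "\<dots> \<le> exp (- (3 * ln n))"
      using qt by simp
    also have "\<dots> = 1 / real n ^ 3"
      using n exp_of_nat_mult[of 3 "ln n"] by (simp add: exp_minus divide_simps)
    finally show ?thesis .
  qed
  let ?F = "\<lambda>qs. reconstruct ?V (map (\<lambda>q. (q, cc_oracle G q)) qs)"
  \<comment> \<open>Contrapositive of \<open>reconstruct_eq\<close>: a wrong output means that some
    pair in \<open>N\<close> is missed by every query.\<close>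
  have "- (?F -` {G}) \<subseteq> (\<Union>x\<in>N. {qs. set qs \<subseteq> - I x})"
  proof (rule subsetI, rule ccontr)
    fix qs assume "qs \<in> - (?F -` {G})" and no: "qs \<notin> (\<Union>x\<in>N. {qs. set qs \<subseteq> - I x})"
    moreover have "?F qs = G"
    proof (rule reconstruct_eq)
      fix u v assume "u \<in> ?V" "v \<in> ?V" "u \<noteq> v" "(u, v) \<notin> parcs G"
      then have "(u, v) \<in> N" by (simp add: N_def)
      then have "\<not> set qs \<subseteq> - I (u, v)" using no by blast
      then show "\<exists>Q\<in>set qs. u \<in> Q \<and> v \<in> Q \<and> (\<forall>w. (u, w) \<in> parcs G \<longrightarrow> w \<notin> Q)"
        by (auto simp: I_def)
    qed
    ultimately show False by simp
  qed
  then have "?P (- (?F -` {G})) \<le> ?P (\<Union>x\<in>N. {qs. set qs \<subseteq> - I x})"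
    by (intro measure_pmf.finite_measure_mono) auto
  also have "\<dots> \<le> (\<Sum>x\<in>N. ?P {qs. set qs \<subseteq> - I x})"
    using finN by (intro measure_pmf.finite_measure_subadditive_finite) auto
  also have "\<dots> \<le> (\<Sum>x\<in>N. 1 / real n ^ 3)"
    by (intro sum_mono survive)
  also have "\<dots> \<le> real (n\<^sup>2) * (1 / real n ^ 3)"
    using cardN by (simp add: divide_right_mono flip: of_nat_power)
  also have "\<dots> = 1 / real n"
    using n by (simp add: power2_eq_square power3_eq_cube)
  finally have "?P (- (?F -` {G})) \<le> 1 / real n" .
  then show ?thesis
    using measure_pmf.prob_compl[of "?F -` {G}" "random_queries ?V ?\<Delta> t"]
    by (simp add: run_nonadaptive_def t_def Compl_eq_Diff_UNIV)
qed

section \<open>Number of queries and the asymptotic statement\<close>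

text \<open>Rounding up costs at most 1, which is absorbed by the summand \<open>1 / ln 2\<close>
  because \<open>ln n\<close> is at least \<open>ln 2\<close> once \<open>n\<close> is at least
  2.\<close>

lemma repetitions_le:
  assumes "c > 0"
  shows "real (repetitions c \<Delta> n) \<le> (c + 1 / ln 2) * (real (max 1 \<Delta>))\<^sup>2 * ln (real n)"
proof (cases "n \<ge> 2")
  case True
  define m where "m = (real (max 1 \<Delta>))\<^sup>2"
  have m: "m \<ge> 1" by (simp add: m_def)
  have ln2: "ln 2 \<le> ln (real n)" using True by simp
  have "1 * ln 2 \<le> m * ln (real n)"
    using m ln2 by (intro mult_mono) auto
  then have "1 \<le> 1 / ln 2 * m * ln (real n)"
    by (simp add: field_simps)
  moreover have "real (repetitions c \<Delta> n) \<le> c * m * ln (real n) + 1"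
    using assms m True unfolding repetitions_def m_def[symmetric]
    by (simp add: of_int_ceiling_le_add_one)
  ultimately show ?thesis
    unfolding m_def[symmetric] distrib_right by linarith
next
  case False
  \<comment> \<open>\<open>ln 0\<close> and \<open>ln 1\<close> are both 0, so both sides
    vanish.\<close>
  then have "n = 0 \<or> n = 1" by auto
  then show ?thesis by (auto simp: repetitions_def)
qed

theorem theorem1:
  shows "\<exists>c > 0.
    (\<exists>K. \<forall>(V :: 'a set) \<Delta>. finite V \<longrightarrow>
       (\<forall>qs \<in> set_pmf (random_queries V \<Delta> (repetitions c \<Delta> (card V))).
          real (length qs) \<le> K * (real (max 1 \<Delta>))\<^sup>2 * ln (real (card V)))) \<and>
    (\<forall>\<epsilon> > 0. \<forall>\<^sub>F n in sequentially. \<forall>(G :: 'a pair_pre_digraph) V \<Delta>.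
       pair_graph G \<and> pverts G = V \<and> card V = n \<and> max_degree G = \<Delta> \<longrightarrow>
       measure_pmf.prob
         (run_nonadaptive (random_queries V \<Delta> (repetitions c \<Delta> n)) (reconstruct V) (cc_oracle G))
         {G} \<ge> 1 - \<epsilon>)"
\<comment> \<open>The second witness is the first plus the rounding constant from
  \<open>repetitions_le\<close>.\<close>
proof (rule exI[of _ "12 * exp 1"], intro conjI exI[of _ "12 * exp 1 + 1 / ln 2"] allI impI ballI)
  show "0 < 12 * exp (1::real)" by simp
next
  fix V :: "'a set" and \<Delta> qs
  assume "qs \<in> set_pmf (random_queries V \<Delta> (repetitions (12 * exp 1) \<Delta> (card V)))"
  then have "length qs = repetitions (12 * exp 1) \<Delta> (card V)"
    by (simp add: random_queries_def set_replicate_pmf)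
  then show "real (length qs) \<le> (12 * exp 1 + 1 / ln 2) * (real (max 1 \<Delta>))\<^sup>2 * ln (real (card V))"
    using repetitions_le[of "12 * exp 1"] by simp
next
  fix \<epsilon> :: real assume "\<epsilon> > 0"
  \<comment> \<open>The error bound \<open>1 / n\<close> is uniform in the graph, so the threshold
    for \<open>n\<close> depends on \<epsilon> alone.\<close>
  then have "\<forall>\<^sub>F n in sequentially. 1 / real n < \<epsilon>"
    using order_tendstoD(2)[OF lim_1_over_n] by blast
  then show "\<forall>\<^sub>F n in sequentially. \<forall>(G :: 'a pair_pre_digraph) V \<Delta>.
       pair_graph G \<and> pverts G = V \<and> card V = n \<and> max_degree G = \<Delta> \<longrightarrow>
       measure_pmf.prob
         (run_nonadaptive (random_queries V \<Delta> (repetitions (12 * exp 1) \<Delta> n)) (reconstruct V)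
           (cc_oracle G)) {G} \<ge> 1 - \<epsilon>"
    using eventually_gt_at_top[of 0]
  proof eventually_elim
    case (elim n)
    then show ?case
      using pair_graph.prob_reconstruct_ge[of _ n] by fastforce
  qed
qed

end
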